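(* For every $l\in\mathbf N$ there exists a constant $a_l>0$ such that for every lattice $\Lambda$ of $\mathbf R^l$, every $\Omega\in\mathbf R^l$ and every $\delta>0$, $$T(\Lambda,\Omega,\delta)\le\big(\alpha(\Lambda,\Omega,a_l/\delta)\big)^{-1}.$$
   Context: A lattice $\Lambda$ of $\mathbf R^l$ is a discrete subgroup such that $\mathbf R^l/\Lambda$ has finite volume. $T(\Lambda,\Omega,\delta)=\inf\{t\in\mathbf R_+:\ \forall x\in\mathbf R^l,\ d(x,[0,t]\Omega+\Lambda)\le\delta\}$, with $d$ the Euclidean distance and $\inf\emptyset=+\infty$. $\Lambda^*=\{p\in\mathbf R^l:\ p\cdot\lambda\in\mathbf Z\ \forall\lambda\in\Lambda\}$, $\Lambda^*_R=\{p\in\Lambda^*:\ 0<|p|\le R\}$ ($|\cdot|$ Euclidean), and $\alpha(\Lambda,\Omega,R)=\inf\{|p\cdot\Omega|:\ p\in\Lambda^*_R\}$. Convention: $\alpha^{-1}=0$ if $\alpha=+\infty$ and $\alpha^{-1}=+\infty$ if $\alpha=0$. *)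

theory Defs
  imports "HOL-Analysis.Analysis"
begin

text \<open>A lattice of R^l: a discrete additive subgroup such that the quotient R^l / Lambda
  has finite volume, i.e. some Lebesgue measurable set of finite measure covers R^l
  by Lambda-translates.\<close>
definition is_lattice :: "(real ^ 'n) set \<Rightarrow> bool" where
  "is_lattice L \<longleftrightarrow>
     0 \<in> L \<and> (\<forall>x\<in>L. \<forall>y\<in>L. x - y \<in> L) \<and>
     (\<exists>r>0. \<forall>x\<in>L. x \<noteq> 0 \<longrightarrow> norm x \<ge> r) \<and>
     (\<exists>F. F \<in> sets lebesgue \<and> emeasure lebesgue F < \<infinity> \<and>
          (\<forall>x. \<exists>f\<in>F. \<exists>l\<in>L. x = f + l))"

definition orbit_set :: "(real ^ 'n) set \<Rightarrow> real ^ 'n \<Rightarrow> real \<Rightarrow> (real ^ 'n) set" where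
  "orbit_set L \<Omega> t = {s *\<^sub>R \<Omega> + l | s l. s \<in> {0..t} \<and> l \<in> L}"

text \<open>T(Lambda, Omega, delta), valued in the extended reals (Inf of the empty set is +infinity).\<close>
definition Tcov :: "(real ^ 'n) set \<Rightarrow> real ^ 'n \<Rightarrow> real \<Rightarrow> ereal" where
  "Tcov L \<Omega> \<delta> = Inf (ereal ` {t. t \<ge> 0 \<and> (\<forall>x. infdist x (orbit_set L \<Omega> t) \<le> \<delta>)})"

definition dual_lattice :: "(real ^ 'n) set \<Rightarrow> (real ^ 'n) set" where
  "dual_lattice L = {p. \<forall>l\<in>L. p \<bullet> l \<in> \<int>}"

definition dual_ball :: "(real ^ 'n) set \<Rightarrow> real \<Rightarrow> (real ^ 'n) set" where
  "dual_ball L R = {p \<in> dual_lattice L. 0 < norm p \<and> norm p \<le> R}"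

text \<open>alpha(Lambda, Omega, R), in the extended reals (Inf of the empty set is +infinity).\<close>
definition alpha :: "(real ^ 'n) set \<Rightarrow> real ^ 'n \<Rightarrow> real \<Rightarrow> ereal" where
  "alpha L \<Omega> R = Inf ((\<lambda>p. ereal \<bar>p \<bullet> \<Omega>\<bar>) ` dual_ball L R)"

definition inv_conv :: "ereal \<Rightarrow> ereal" where
  "inv_conv a = (if a = \<infinity> then 0 else if a = 0 then \<infinity> else ereal (1 / real_of_ereal a))"

end

theory Submission
  imports Defs "HOL-Computational_Algebra.Group_Closure"
begin

text \<open>
  Put \<open>v = \<Omega> / \<alpha>\<close>. The claim says that the \<open>\<Lambda>\<close>-translates of the \<open>\<delta>\<close>-neighbourhood of the
  segment \<open>[0, v]\<close> cover space if \<open>\<bar>q \<bullet> v\<bar> \<ge> 1\<close> for every nonzero dual vector \<open>q\<close> with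
  \<open>\<bar>q\<bar> \<le> a / \<delta>\<close>. A transference theorem, proved by induction on the dimension, gives the covering
  under the stronger hypothesis \<open>\<bar>q \<bullet> v\<bar> \<ge> 2c\<close> for \<open>\<bar>q\<bar> \<le> c / \<delta>\<close>, because the neighbourhood
  contains an ellipsoid. To replace the bound \<open>2c\<close> by 1, consider radii
  \<open>a\<^sub>0 / \<delta> < a\<^sub>1 / \<delta> < \<dots> < a\<^sub>N / \<delta>\<close>. Either the minimum of \<open>\<bar>q \<bullet> v\<bar>\<close> at least doubles each time
  the radius is lowered by one step, and the transference version applies at \<open>a\<^sub>0\<close>; or, after
  shortening \<open>v\<close>, some \<open>p\<close> of the smaller radius has \<open>1 \<le> p \<bullet> v < 2\<close> while \<open>\<bar>q \<bullet> v\<bar> \<ge> 1\<close> on the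
  larger one. In the latter case, for a functional \<open>q\<close> on the hyperplane orthogonal to \<open>p\<close>, the
  values at \<open>v\<close> of its lifts \<open>q + m p\<close> form an arithmetic progression of step less than 2 that
  avoids \<open>(-1, 1)\<close> in a long range of \<open>m\<close>; hence \<open>\<bar>q \<bullet> v\<bar>\<close> is large, and the transference version
  applies in that hyperplane.
\<close>

section \<open>Discrete subgroups and shortest vectors\<close>

definition additive_subgroup :: "'a::ab_group_add set \<Rightarrow> bool" where
  "additive_subgroup G \<longleftrightarrow> 0 \<in> G \<and> (\<forall>x\<in>G. \<forall>y\<in>G. x - y \<in> G)"

definition discrete_subgroup :: "'a::real_normed_vector set \<Rightarrow> bool" where
  "discrete_subgroup L \<longleftrightarrow> additive_subgroup L \<and> uniform_discrete L"

lemma additive_subgroup_zero: "additive_subgroup G \<Longrightarrow> 0 \<in> G"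
  by (simp add: additive_subgroup_def)

lemma additive_subgroup_diff: "additive_subgroup G \<Longrightarrow> x \<in> G \<Longrightarrow> y \<in> G \<Longrightarrow> x - y \<in> G"
  by (simp add: additive_subgroup_def)

lemma additive_subgroup_minus: "additive_subgroup G \<Longrightarrow> x \<in> G \<Longrightarrow> - x \<in> G"
  using additive_subgroup_diff[OF _ additive_subgroup_zero, of G x] by simp

lemma additive_subgroup_add: "additive_subgroup G \<Longrightarrow> x \<in> G \<Longrightarrow> y \<in> G \<Longrightarrow> x + y \<in> G"
  using additive_subgroup_diff[OF _ _ additive_subgroup_minus, of G x y] by simp

lemma additive_subgroup_of_int_scaleR:
  fixes G :: "'a::real_vector set"
  assumes G: "additive_subgroup G" and x: "x \<in> G"
  shows "of_int k *\<^sub>R x \<in> G"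
proof (induction k rule: int_induct[where k = 0])
  case base
  show ?case using additive_subgroup_zero[OF G] by simp
next
  case (step1 i)
  then show ?case using additive_subgroup_add[OF G _ x] by (simp add: scaleR_left_distrib)
next
  case (step2 i)
  then show ?case using additive_subgroup_diff[OF G _ x] by (simp add: scaleR_left_diff_distrib)
qed

lemma additive_subgroup_int_eq_multiples:
  fixes G :: "int set"
  assumes "additive_subgroup G"
  shows "G = range ((*) (Gcd G))"
proof -
  have "n \<in> G" if "n \<in> group_closure G" for n
    using that assms by induction (auto simp: additive_subgroup_def)
  then have "group_closure G = G"
    by (auto intro: group_closure.base)
  then show ?thesis
    by (simp add: group_closure_eq)
qed

lemma additive_subgroup_linear_image:
  assumes "linear f" "additive_subgroup G"
  shows "additive_subgroup (f ` G)"
  using assms(2) linear_0[OF assms(1)]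
  by (force simp: additive_subgroup_def simp flip: linear_diff[OF assms(1)])

lemma discrete_subgroupI:
  assumes G: "additive_subgroup G" and r: "0 < r" "\<And>x. x \<in> G \<Longrightarrow> x \<noteq> 0 \<Longrightarrow> r \<le> norm x"
  shows "discrete_subgroup G"
proof -
  have "x = y" if "x \<in> G" "y \<in> G" "dist x y < r" for x y
    using r(2)[of "x - y"] additive_subgroup_diff[OF G that(1,2)] that(3) by (force simp: dist_norm)
  then show ?thesis
    using G r(1) unfolding discrete_subgroup_def uniform_discrete_def by blast
qed

lemma discrete_subgroup_norm_ge:
  assumes "discrete_subgroup L"
  obtains r where "0 < r" "\<And>x. x \<in> L \<Longrightarrow> x \<noteq> 0 \<Longrightarrow> r \<le> norm x"
proof -
  obtain r where "0 < r" "\<And>x y. x \<in> L \<Longrightarrow> y \<in> L \<Longrightarrow> dist x y < r \<Longrightarrow> x = y"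
    using assms unfolding discrete_subgroup_def uniform_discrete_def by blast
  moreover have "0 \<in> L"
    using assms by (simp add: discrete_subgroup_def additive_subgroup_zero)
  ultimately show thesis
    using that[of r] by (metis dist_0_norm not_less)
qed

lemma discrete_subgroup_linear_vimage:
  fixes f :: "'a::euclidean_space \<Rightarrow> 'b::euclidean_space"
  assumes f: "linear f" "inj f" and L: "discrete_subgroup L"
  shows "discrete_subgroup (f -` L)"
proof -
  obtain r where r: "0 < r" "\<And>x. x \<in> L \<Longrightarrow> x \<noteq> 0 \<Longrightarrow> r \<le> norm x"
    using discrete_subgroup_norm_ge[OF L] by blast
  obtain K where K: "0 < K" "\<And>x. norm (f x) \<le> norm x * K"
    using bounded_linear.pos_bounded linear_conv_bounded_linear f(1) by blast
  have "r / K \<le> norm x" if "x \<in> f -` L" "x \<noteq> 0" for x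
  proof -
    have "f x \<noteq> 0"
      using that(2) f linear_injective_0 by blast
    then have "r \<le> norm x * K"
      using r(2)[of "f x"] K(2)[of x] that(1) by force
    then show ?thesis
      using K(1) by (simp add: field_simps)
  qed
  moreover have "additive_subgroup (f -` L)"
    using L f(1) by (auto simp: discrete_subgroup_def additive_subgroup_def linear_0 linear_diff)
  ultimately show ?thesis
    using r(1) K(1) by (intro discrete_subgroupI[of _ "r / K"]) auto
qed

definition shortest_vector :: "'a::real_normed_vector set \<Rightarrow> 'a \<Rightarrow> bool" where
  "shortest_vector L b \<longleftrightarrow> b \<in> L \<and> b \<noteq> 0 \<and> (\<forall>x\<in>L. x \<noteq> 0 \<longrightarrow> norm b \<le> norm x)"

lemma shortest_vector_exists:
  fixes L :: "'a::euclidean_space set"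
  assumes "uniform_discrete L" "x \<in> L" "x \<noteq> 0"
  shows "\<exists>b. shortest_vector L b"
proof -
  have "closed (L - {0})"
    using assms(1) by (intro uniform_discrete_imp_closed) auto
  then obtain b where "b \<in> L - {0}" "\<And>y. y \<in> L - {0} \<Longrightarrow> dist 0 b \<le> dist 0 y"
    using distance_attains_inf[of "L - {0}" 0] assms(2,3) by blast
  then show ?thesis
    by (auto simp: shortest_vector_def)
qed

definition hyperplane_proj :: "'a::real_inner \<Rightarrow> 'a \<Rightarrow> 'a" where
  "hyperplane_proj p x = x - ((p \<bullet> x) / (p \<bullet> p)) *\<^sub>R p"

lemma linear_hyperplane_proj: "linear (hyperplane_proj p)"
  unfolding hyperplane_proj_def
  by (rule linearI) (auto simp: algebra_simps inner_add_right add_divide_distrib)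

lemma inner_hyperplane_proj_self [simp]: "p \<bullet> hyperplane_proj p x = 0"
  by (cases "p = 0") (simp_all add: hyperplane_proj_def inner_diff_right)

lemma inner_hyperplane_proj: "q \<bullet> p = 0 \<Longrightarrow> q \<bullet> hyperplane_proj p x = q \<bullet> x"
  by (simp add: hyperplane_proj_def inner_diff_right)

lemma hyperplane_proj_eq_self: "p \<bullet> x = 0 \<Longrightarrow> hyperplane_proj p x = x"
  by (simp add: hyperplane_proj_def)

lemma hyperplane_proj_scaleR_self [simp]: "hyperplane_proj p (c *\<^sub>R p) = 0"
  by (cases "p = 0") (simp_all add: hyperplane_proj_def)

lemma norm_diff_hyperplane_proj: "norm (x - hyperplane_proj p x) = \<bar>p \<bullet> x\<bar> / norm p"
  by (cases "p = 0")
    (simp_all add: hyperplane_proj_def power2_norm_eq_inner[symmetric] power2_eq_square)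

lemma norm_diff_le_hyperplane_proj:
  "norm (x - y) \<le> norm (hyperplane_proj p x - y) + \<bar>p \<bullet> x\<bar> / norm p"
  using norm_triangle_ineq[of "hyperplane_proj p x - y" "x - hyperplane_proj p x"]
  by (simp add: norm_diff_hyperplane_proj)

lemma hyperplane_proj_mem_subspace:
  "subspace V \<Longrightarrow> p \<in> V \<Longrightarrow> x \<in> V \<Longrightarrow> hyperplane_proj p x \<in> V"
  by (simp add: hyperplane_proj_def subspace_diff subspace_scale)

text \<open>Subtracting a suitable multiple of \<open>b\<close> moves \<open>x\<close> to distance at most \<open>\<bar>b\<bar> / 2\<close> from its projection.\<close>

lemma multiple_of_shortest_vector:
  assumes L: "additive_subgroup L" and b: "shortest_vector L b"
    and x: "x \<in> L" "norm (hyperplane_proj b x) < norm b / 2"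
  shows "\<exists>k. x = of_int k *\<^sub>R b"
proof -
  define t where "t = (b \<bullet> x) / (b \<bullet> b)"
  define y where "y = x - of_int (round t) *\<^sub>R b"
  have "y \<in> L"
    using additive_subgroup_diff[OF L x(1) additive_subgroup_of_int_scaleR[OF L]] b
    by (simp add: y_def shortest_vector_def)
  have "y = hyperplane_proj b x + (t - of_int (round t)) *\<^sub>R b"
    by (simp add: y_def t_def hyperplane_proj_def algebra_simps)
  then have "norm y \<le> norm (hyperplane_proj b x) + \<bar>t - of_int (round t)\<bar> * norm b"
    using norm_triangle_ineq[of "hyperplane_proj b x" "(t - of_int (round t)) *\<^sub>R b"] by simp
  also have "\<bar>t - of_int (round t)\<bar> * norm b \<le> 1 / 2 * norm b"
    using of_int_round_abs_le[of t] by (intro mult_right_mono) (auto simp: abs_minus_commute)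
  finally have "norm y < norm b"
    using x(2) by simp
  then have "y = 0"
    using b \<open>y \<in> L\<close> by (force simp: shortest_vector_def)
  then show ?thesis
    by (auto simp: y_def)
qed

lemma norm_hyperplane_proj_shortest_ge:
  assumes "additive_subgroup L" "shortest_vector L b" "x \<in> L" "hyperplane_proj b x \<noteq> 0"
  shows "norm b / 2 \<le> norm (hyperplane_proj b x)"
  using multiple_of_shortest_vector[OF assms(1-3)] assms(4) by force

lemma discrete_subgroup_hyperplane_proj:
  assumes "additive_subgroup L" "shortest_vector L b"
  shows "discrete_subgroup (hyperplane_proj b ` L)"
proof (rule discrete_subgroupI)
  show "additive_subgroup (hyperplane_proj b ` L)"
    using linear_hyperplane_proj assms(1) by (rule additive_subgroup_linear_image)
  show "0 < norm b / 2"
    using assms(2) by (simp add: shortest_vector_def)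
  show "norm b / 2 \<le> norm y" if "y \<in> hyperplane_proj b ` L" "y \<noteq> 0" for y
    using norm_hyperplane_proj_shortest_ge[OF assms] that by blast
qed

section \<open>Dual vectors and sections\<close>

text \<open>The dual is taken inside the span, so that it is again discrete when \<open>L\<close> does not span.\<close>

definition relative_dual :: "'a::real_inner set \<Rightarrow> 'a set" where
  "relative_dual L = {p \<in> span L. \<forall>x\<in>L. p \<bullet> x \<in> \<int>}"

lemma additive_subgroup_relative_dual: "additive_subgroup (relative_dual L)"
  by (auto simp: additive_subgroup_def relative_dual_def span_zero span_diff inner_diff_left)

lemma relative_dual_hyperplane_proj_subset:
  assumes "b \<in> L"
  shows "relative_dual (hyperplane_proj b ` L) \<subseteq> relative_dual L"
proof
  fix p assume p: "p \<in> relative_dual (hyperplane_proj b ` L)"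
  then have "p \<in> hyperplane_proj b ` span L"
    by (simp add: relative_dual_def span_linear_image[OF linear_hyperplane_proj])
  then obtain y where y: "y \<in> span L" "p = hyperplane_proj b y"
    by blast
  have "p \<bullet> b = 0"
    by (simp add: y(2) inner_commute)
  then have "p \<bullet> x \<in> \<int>" if "x \<in> L" for x
    using p that inner_hyperplane_proj[of p b x] by (force simp: relative_dual_def)
  moreover have "p \<in> span L"
    using assms y by (simp add: hyperplane_proj_mem_subspace span_base)
  ultimately show "p \<in> relative_dual L"
    by (simp add: relative_dual_def)
qed

lemma dim_hyperplane_proj_image_less:
  fixes L :: "'a::euclidean_space set"
  assumes "b \<in> span L" "b \<noteq> 0"
  shows "dim (hyperplane_proj b ` L) < dim L"
proof (rule dim_psubset)
  have span: "span (hyperplane_proj b ` L) = hyperplane_proj b ` span L"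
    by (rule span_linear_image[OF linear_hyperplane_proj])
  have "b \<notin> hyperplane_proj b ` span L"
    using assms(2) inner_hyperplane_proj_self by (metis imageE inner_eq_zero_iff)
  then show "span (hyperplane_proj b ` L) \<subset> span L"
    unfolding span using assms(1) by (auto intro!: hyperplane_proj_mem_subspace)
qed

lemma relative_dual_nontrivial:
  fixes L :: "'a::euclidean_space set"
  assumes "discrete_subgroup L" "x \<in> L" "x \<noteq> 0"
  shows "\<exists>p\<in>relative_dual L. p \<noteq> 0"
  using assms
proof (induction "dim L" arbitrary: L x rule: less_induct)
  case less
  have L: "additive_subgroup L"
    using less.prems(1) by (simp add: discrete_subgroup_def)
  obtain b where b: "shortest_vector L b"
    using less.prems shortest_vector_exists by (auto simp: discrete_subgroup_def)
  then have bL: "b \<in> L" "b \<noteq> 0"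
    by (auto simp: shortest_vector_def)
  show ?case
  proof (cases "\<exists>y\<in>L. hyperplane_proj b y \<noteq> 0")
    case True
    then obtain p where "p \<in> relative_dual (hyperplane_proj b ` L)" "p \<noteq> 0"
      using less.hyps[OF dim_hyperplane_proj_image_less discrete_subgroup_hyperplane_proj[OF L b]]
        bL by (auto intro: span_base)
    then show ?thesis
      using relative_dual_hyperplane_proj_subset[OF bL(1)] by blast
  next
    case False
    have "(b /\<^sub>R (b \<bullet> b)) \<bullet> y \<in> \<int>" if y: "y \<in> L" for y
    proof -
      obtain k where "y = of_int k *\<^sub>R b"
        using multiple_of_shortest_vector[OF L b y] False y bL(2) by auto
      then show ?thesis
        using bL(2) by simp
    qed
    then show ?thesis
      using bL by (intro bexI[of _ "b /\<^sub>R (b \<bullet> b)"])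
        (auto simp: relative_dual_def span_base span_scale)
  qed
qed

definition hyperplane_section :: "'a::real_inner \<Rightarrow> 'a set \<Rightarrow> 'a set" where
  "hyperplane_section p L = {x \<in> L. p \<bullet> x = 0}"

lemma discrete_subgroup_hyperplane_section:
  assumes "discrete_subgroup L"
  shows "discrete_subgroup (hyperplane_section p L)"
proof -
  have "uniform_discrete (hyperplane_section p L)"
    using assms unfolding discrete_subgroup_def
    by (auto intro: uniform_discrete_subset simp: hyperplane_section_def)
  then show ?thesis
    using assms by (auto simp: discrete_subgroup_def additive_subgroup_def hyperplane_section_def
        inner_diff_right)
qed

locale primitive_dual_vector =
  fixes L :: "'a::euclidean_space set" and p b :: 'a
  assumes subgroup: "additive_subgroup L"
    and dual: "p \<in> relative_dual L"
    and mem: "b \<in> L"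
    and pairing: "p \<bullet> b = 1"
begin

lemma nonzero: "p \<noteq> 0"
  using pairing by auto

lemma shear_mem_section:
  assumes "x \<in> L"
  shows "x - (p \<bullet> x) *\<^sub>R b \<in> hyperplane_section p L"
proof -
  obtain k where "p \<bullet> x = of_int k"
    using dual assms by (auto simp: relative_dual_def elim!: Ints_cases)
  then show ?thesis
    using additive_subgroup_diff[OF subgroup assms additive_subgroup_of_int_scaleR[OF subgroup mem]]
    by (simp add: hyperplane_section_def inner_diff_right pairing)
qed

lemma span_section: "span (hyperplane_section p L) = {x \<in> span L. p \<bullet> x = 0}" (is "_ = ?V")
proof
  have "subspace ?V"
    by (auto simp: subspace_def span_zero span_add span_scale inner_add_right)
  then show "span (hyperplane_section p L) \<subseteq> ?V"
    by (intro span_minimal) (auto simp: hyperplane_section_def span_base)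
  have shear: "linear (\<lambda>x. x - (p \<bullet> x) *\<^sub>R b)"
    by (rule linearI) (auto simp: algebra_simps inner_add_right)
  show "?V \<subseteq> span (hyperplane_section p L)"
  proof
    fix x assume x: "x \<in> ?V"
    then have "x - (p \<bullet> x) *\<^sub>R b \<in> (\<lambda>x. x - (p \<bullet> x) *\<^sub>R b) ` span L"
      by blast
    also have "\<dots> \<subseteq> span (hyperplane_section p L)"
      unfolding span_linear_image[OF shear, symmetric]
      using shear_mem_section by (intro span_mono) blast
    finally show "x \<in> span (hyperplane_section p L)"
      using x by simp
  qed
qed

lemma dim_section_less: "dim (hyperplane_section p L) < dim L"
proof (rule dim_psubset)
  have "p \<in> span L - span (hyperplane_section p L)"
    using dual nonzero by (simp add: span_section relative_dual_def)
  then show "span (hyperplane_section p L) \<subset> span L"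
    unfolding span_section by blast
qed

lemma hyperplane_proj_mem_span_section:
  assumes "x \<in> span L"
  shows "hyperplane_proj p x \<in> span (hyperplane_section p L)"
  using assms dual
  by (auto simp: span_section relative_dual_def intro: hyperplane_proj_mem_subspace)

lemma inner_dual_section_eq_0:
  assumes "q \<in> relative_dual (hyperplane_section p L)"
  shows "q \<bullet> p = 0"
  using assms by (simp add: relative_dual_def span_section inner_commute)

lemma lift_dual_section:
  assumes q: "q \<in> relative_dual (hyperplane_section p L)"
  shows "q - (q \<bullet> b) *\<^sub>R p \<in> relative_dual L"
proof -
  have "(q - (q \<bullet> b) *\<^sub>R p) \<bullet> x \<in> \<int>" if "x \<in> L" for x
  proof -
    have "q \<bullet> (x - (p \<bullet> x) *\<^sub>R b) \<in> \<int>"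
      using q shear_mem_section[OF that] by (simp add: relative_dual_def)
    then show ?thesis
      by (simp add: inner_diff_left inner_diff_right mult.commute)
  qed
  then show ?thesis
    using q dual by (simp add: relative_dual_def span_section span_diff span_scale)
qed

end

lemma span_inner_nonzero:
  assumes "p \<in> span L" "p \<noteq> 0"
  shows "\<exists>x\<in>L. p \<bullet> x \<noteq> 0"
proof (rule ccontr)
  assume "\<not> ?thesis"
  then have "orthogonal p p"
    by (intro orthogonal_to_span[OF assms(1)]) (simp add: orthogonal_def)
  then show False
    using assms(2) by (simp add: orthogonal_def)
qed

lemma relative_dual_values_eq_multiples:
  assumes "additive_subgroup L" "p \<in> relative_dual L"
  obtains m :: nat where "(\<lambda>x. p \<bullet> x) ` L = range (\<lambda>k. real m * of_int k)"
proof -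
  define G where "G = {n. \<exists>x\<in>L. p \<bullet> x = of_int n}"
  have "0 \<in> G"
    using additive_subgroup_zero[OF assms(1)] by (auto simp: G_def intro: bexI[of _ 0])
  moreover have "n - k \<in> G" if "n \<in> G" "k \<in> G" for n k
    using that additive_subgroup_diff[OF assms(1)] by (force simp: G_def inner_diff_right)
  ultimately have "G = range ((*) (Gcd G))"
    by (intro additive_subgroup_int_eq_multiples) (auto simp: additive_subgroup_def)
  moreover have "(\<lambda>x. p \<bullet> x) ` L = of_int ` G"
    using assms(2) by (force simp: G_def relative_dual_def elim!: Ints_cases)
  ultimately have "(\<lambda>x. p \<bullet> x) ` L = (\<lambda>k. of_int (Gcd G * k)) ` UNIV"
    by (metis image_image)
  then show thesis
    using that[of "nat (Gcd G)"] by simp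
qed

lemma primitive_dual_vector_on_line:
  fixes L :: "'a::euclidean_space set"
  assumes L: "additive_subgroup L" and p: "p \<in> relative_dual L" "p \<noteq> 0"
  obtains k b where "0 < k" "k \<le> 1" "primitive_dual_vector L (k *\<^sub>R p) b"
proof -
  obtain m :: nat where m: "(\<lambda>x. p \<bullet> x) ` L = range (\<lambda>k. real m * of_int k)"
    using relative_dual_values_eq_multiples[OF L p(1)] .
  have multiple: "\<exists>k. p \<bullet> x = real m * of_int k" if "x \<in> L" for x
    using imageI[OF that, of "(\<bullet>) p"] unfolding m by blast
  obtain x where "x \<in> L" "p \<bullet> x \<noteq> 0"
    using span_inner_nonzero p unfolding relative_dual_def by blast
  then have "m \<noteq> 0"
    using multiple by force
  have "real m \<in> range (\<lambda>k. real m * of_int k)"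
    by (rule range_eqI[of _ _ 1]) simp
  then obtain b where "b \<in> L" "p \<bullet> b = real m"
    unfolding m[symmetric] by fastforce
  moreover have "((1 / real m) *\<^sub>R p) \<bullet> y \<in> \<int>" if "y \<in> L" for y
    using multiple[OF that] \<open>m \<noteq> 0\<close> by auto
  ultimately have "primitive_dual_vector L ((1 / real m) *\<^sub>R p) b"
    using L p(1) \<open>m \<noteq> 0\<close> by unfold_locales (auto simp: relative_dual_def span_scale)
  then show thesis
    using that[of "1 / real m" b] \<open>m \<noteq> 0\<close> by simp
qed

section \<open>Transference\<close>

definition translates_cover :: "'a::real_vector set \<Rightarrow> 'a set \<Rightarrow> bool" where
  "translates_cover L K \<longleftrightarrow> (\<forall>x\<in>span L. \<exists>l\<in>L. x - l \<in> K)"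

lemma translates_cover_mono: "translates_cover L K \<Longrightarrow> K \<subseteq> K' \<Longrightarrow> translates_cover L K'"
  unfolding translates_cover_def by blast

lemma translates_cover_translation:
  assumes "translates_cover L K" "a \<in> span L"
  shows "translates_cover L ((+) a ` K)"
  unfolding translates_cover_def
proof
  fix x assume "x \<in> span L"
  then obtain l where "l \<in> L" "(x - a) - l \<in> K"
    using assms span_diff unfolding translates_cover_def by blast
  then show "\<exists>l\<in>L. x - l \<in> (+) a ` K"
    by (intro bexI[of _ l] image_eqI[of _ _ "x - a - l"]) auto
qed

lemma translates_cover_linear_image:
  assumes "linear f" "translates_cover L K"
  shows "translates_cover (f ` L) (f ` K)"
  unfolding translates_cover_def span_linear_image[OF assms(1)]
proof
  fix y assume "y \<in> f ` span L"
  then obtain x l where "y = f x" "l \<in> L" "x - l \<in> K"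
    using assms(2) by (auto simp: translates_cover_def)
  then show "\<exists>l\<in>f ` L. y - l \<in> f ` K"
    using linear_diff[OF assms(1), of x l] by (metis image_eqI)
qed

lemma translates_cover_trivial:
  assumes "L = {0}" "0 \<in> K"
  shows "translates_cover L K"
  using assms by (simp add: translates_cover_def)

context primitive_dual_vector
begin

lemma translates_cover_if_slab:
  assumes slab: "\<And>y. y \<in> span L \<Longrightarrow> a \<le> p \<bullet> y \<Longrightarrow> p \<bullet> y < a + 1 \<Longrightarrow>
    \<exists>l\<in>hyperplane_section p L. y - l \<in> K"
  shows "translates_cover L K"
  unfolding translates_cover_def
proof
  fix x assume x: "x \<in> span L"
  define z where "z = of_int \<lfloor>p \<bullet> x - a\<rfloor> *\<^sub>R b"
  have z: "z \<in> L"
    using additive_subgroup_of_int_scaleR[OF subgroup mem] by (simp add: z_def)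
  have "p \<bullet> (x - z) = p \<bullet> x - \<lfloor>p \<bullet> x - a\<rfloor>"
    by (simp add: z_def inner_diff_right pairing)
  then have "a \<le> p \<bullet> (x - z)" "p \<bullet> (x - z) < a + 1"
    by linarith+
  then obtain l where "l \<in> L" "x - (z + l) \<in> K"
    using slab[of "x - z"] x z
    by (auto simp: span_diff span_base hyperplane_section_def diff_diff_eq)
  then show "\<exists>l\<in>L. x - l \<in> K"
    using additive_subgroup_add[OF subgroup z] by blast
qed

lemma norm_dual_section_ge:
  assumes "shortest_vector (relative_dual L) p"
    and q: "q \<in> relative_dual (hyperplane_section p L)" "q \<noteq> 0"
  shows "norm p / 2 \<le> norm q"
proof -
  have "hyperplane_proj p (q - (q \<bullet> b) *\<^sub>R p) = q"
    using inner_dual_section_eq_0[OF q(1)]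
    by (simp add: linear_diff[OF linear_hyperplane_proj] hyperplane_proj_eq_self inner_commute)
  then show ?thesis
    using norm_hyperplane_proj_shortest_ge[OF additive_subgroup_relative_dual assms(1)
        lift_dual_section] q by metis
qed

lemma translates_cover_cball:
  assumes cover: "translates_cover (hyperplane_section p L) (cball 0 \<rho>)"
  shows "translates_cover L (cball 0 (\<rho> + 1 / (2 * norm p)))"
proof (rule translates_cover_if_slab[of "- 1/2"])
  fix y assume y: "y \<in> span L" "- 1/2 \<le> p \<bullet> y" "p \<bullet> y < - 1/2 + 1"
  obtain l where l: "l \<in> hyperplane_section p L" "norm (hyperplane_proj p y - l) \<le> \<rho>"
    using cover hyperplane_proj_mem_span_section[OF y(1)] by (auto simp: translates_cover_def)
  have "\<bar>p \<bullet> y\<bar> / norm p \<le> (1/2) / norm p"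
    using y(2,3) by (intro divide_right_mono) auto
  then have "norm (y - l) \<le> \<rho> + 1 / (2 * norm p)"
    using norm_diff_le_hyperplane_proj[of y l p] l(2) by simp
  then show "\<exists>l\<in>hyperplane_section p L. y - l \<in> cball 0 (\<rho> + 1 / (2 * norm p))"
    using l(1) by auto
qed

lemma translates_cover_cball_power:
  assumes "translates_cover (hyperplane_section p L)
    (cball 0 (3 ^ dim (hyperplane_section p L) / (norm p / 2)))"
  shows "translates_cover L (cball 0 (3 ^ dim L / norm p))"
proof -
  define d where "d = dim (hyperplane_section p L)"
  have "3 ^ d / (norm p / 2) + 1 / (2 * norm p) = (2 * 3 ^ d + 1/2) / norm p"
    using nonzero by (simp add: field_simps)
  also have "2 * 3 ^ d + 1/2 \<le> (3::real) ^ Suc d"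
    using one_le_power[of "3::real" d] unfolding power_Suc by linarith
  also have "\<dots> \<le> 3 ^ dim L"
    using dim_section_less by (intro power_increasing) (auto simp: d_def)
  finally have "3 ^ d / (norm p / 2) + 1 / (2 * norm p) \<le> 3 ^ dim L / norm p"
    by (simp add: divide_right_mono)
  then show ?thesis
    using translates_cover_cball[OF assms] unfolding d_def
    by (meson translates_cover_mono subset_cball)
qed

end

lemma primitive_shortest_dual_vector_exists:
  fixes L :: "'a::euclidean_space set"
  assumes L: "additive_subgroup L"
    and dual: "uniform_discrete (relative_dual L)" "q \<in> relative_dual L" "q \<noteq> 0"
  obtains p b where "primitive_dual_vector L p b" "shortest_vector (relative_dual L) p"
proof -
  obtain p where p: "shortest_vector (relative_dual L) p"
    using shortest_vector_exists dual by blast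
  then obtain k b where k: "0 < k" "k \<le> 1" and prim: "primitive_dual_vector L (k *\<^sub>R p) b"
    using primitive_dual_vector_on_line[OF L] by (auto simp: shortest_vector_def)
  have "norm (k *\<^sub>R p) \<le> norm p"
    using k by (simp add: mult_left_le_one_le)
  then have "shortest_vector (relative_dual L) (k *\<^sub>R p)"
    using p primitive_dual_vector.dual[OF prim] primitive_dual_vector.nonzero[OF prim]
    unfolding shortest_vector_def by (meson order_trans)
  then show thesis
    using that prim by blast
qed

text \<open>Each dimension contributes half the distance of the layers of a shortest dual vector, while
  passing to a layer at most halves the length of the shortest dual vector.\<close>

lemma transference:
  fixes L :: "'a::euclidean_space set"
  assumes "discrete_subgroup L" "0 < r" "\<And>q. q \<in> relative_dual L \<Longrightarrow> q \<noteq> 0 \<Longrightarrow> r \<le> norm q"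
  shows "translates_cover L (cball 0 (3 ^ dim L / r))"
  using assms
proof (induction "dim L" arbitrary: L r rule: less_induct)
  case less
  have L: "additive_subgroup L"
    using less.prems(1) by (simp add: discrete_subgroup_def)
  show ?case
  proof (cases "L = {0}")
    case True
    then show ?thesis
      using less.prems(2) by (intro translates_cover_trivial) auto
  next
    case False
    then obtain q where "q \<in> relative_dual L" "q \<noteq> 0"
      using relative_dual_nontrivial[OF less.prems(1)] additive_subgroup_zero[OF L] by blast
    moreover have "uniform_discrete (relative_dual L)"
      using discrete_subgroupI[OF additive_subgroup_relative_dual less.prems(2,3)]
      by (simp add: discrete_subgroup_def)
    ultimately obtain p b where prim: "primitive_dual_vector L p b"
      and p: "shortest_vector (relative_dual L) p"
      using primitive_shortest_dual_vector_exists[OF L] by metis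
    interpret primitive_dual_vector L p b by (rule prim)
    have "translates_cover L (cball 0 (3 ^ dim L / norm p))"
      using less.prems(1) p nonzero
      by (intro translates_cover_cball_power less.hyps dim_section_less
          discrete_subgroup_hyperplane_section norm_dual_section_ge) auto
    moreover have "3 ^ dim L / norm p \<le> 3 ^ dim L / r"
      using less.prems p by (intro frac_le) (auto simp: shortest_vector_def)
    ultimately show ?thesis
      by (meson translates_cover_mono subset_cball)
  qed
qed

lemma linear_inj_image_subspace_eq:
  fixes f :: "'a::euclidean_space \<Rightarrow> 'a"
  assumes "linear f" "inj f" "subspace V" "f ` V \<subseteq> V"
  shows "f ` V = V"
  using assms dim_image_eq[of f V] inj_on_subset[of f UNIV]
  by (intro subspace_dim_equal linear_subspace_image) auto

lemma span_linear_vimage: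
  fixes f :: "'a::euclidean_space \<Rightarrow> 'a"
  assumes f: "linear f" "inj f" "f ` span L \<subseteq> span L"
  shows "span (f -` L) = span L"
proof -
  have "f ` (f -` L) = L"
    using linear_inj_imp_surj[OF f(1,2)] by (rule surj_image_vimage_eq)
  then have "f ` span (f -` L) = span L"
    using span_linear_image[OF f(1), of "f -` L"] by simp
  also have "\<dots> = f ` span L"
    using linear_inj_image_subspace_eq[OF f(1,2) subspace_span f(3)] by simp
  finally have "f ` span (f -` L) = f ` span L" .
  then show ?thesis
    using f(2) by (simp add: inj_image_eq_iff)
qed

lemma relative_dual_linear_vimage:
  fixes f :: "'a::euclidean_space \<Rightarrow> 'a"
  assumes f: "linear f" "inj f" "f ` span L \<subseteq> span L" and self_adjoint: "\<And>x y. f x \<bullet> y = x \<bullet> f y"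
  shows "relative_dual (f -` L) \<subseteq> f ` relative_dual L"
proof
  fix q assume q: "q \<in> relative_dual (f -` L)"
  then have "q \<in> f ` span L"
    using span_linear_vimage[OF f] linear_inj_image_subspace_eq[OF f(1,2) _ f(3)]
    by (simp add: relative_dual_def)
  then obtain p where p: "p \<in> span L" "q = f p"
    by blast
  have "p \<bullet> x \<in> \<int>" if "x \<in> L" for x
  proof -
    obtain y where "x = f y"
      using linear_inj_imp_surj[OF f(1,2)] by (rule surjE)
    then show ?thesis
      using q that by (auto simp: relative_dual_def p(2) self_adjoint)
  qed
  then show "q \<in> f ` relative_dual L"
    using p by (auto simp: relative_dual_def)
qed

lemma transference_self_adjoint:
  fixes L :: "'a::euclidean_space set"
  assumes L: "discrete_subgroup L"
    and f: "linear f" "inj f" "f ` span L \<subseteq> span L" "\<And>x y. f x \<bullet> y = x \<bullet> f y"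
    and r: "0 < r" "\<And>q. q \<in> relative_dual L \<Longrightarrow> q \<noteq> 0 \<Longrightarrow> r \<le> norm (f q)"
  shows "translates_cover L (f ` cball 0 (3 ^ dim L / r))"
proof -
  have "r \<le> norm q" if "q \<in> relative_dual (f -` L)" "q \<noteq> 0" for q
    using relative_dual_linear_vimage[OF f] that r(2) linear_0[OF f(1)] by blast
  then have "translates_cover (f -` L) (cball 0 (3 ^ dim (f -` L) / r))"
    using transference[OF discrete_subgroup_linear_vimage[OF f(1,2) L] r(1)] by blast
  moreover have "dim (f -` L) = dim L"
    using span_linear_vimage[OF f(1-3)] by (metis dim_span)
  moreover have "f ` (f -` L) = L"
    using linear_inj_imp_surj[OF f(1,2)] by (rule surj_image_vimage_eq)
  ultimately show ?thesis
    using translates_cover_linear_image[OF f(1)] by metis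
qed

section \<open>Covering by neighbourhoods of a segment\<close>

definition segment_nbhd :: "'a::real_normed_vector \<Rightarrow> real \<Rightarrow> 'a set" where
  "segment_nbhd v \<delta> = {y. \<exists>s\<in>{0..1}. norm (y - s *\<^sub>R v) \<le> \<delta>}"

lemma segment_nbhd_mono: "\<delta> \<le> \<delta>' \<Longrightarrow> segment_nbhd v \<delta> \<subseteq> segment_nbhd v \<delta>'"
  unfolding segment_nbhd_def by (blast intro: order_trans)

lemma segment_nbhd_scaleR_subset:
  assumes "k \<in> {0..1}"
  shows "segment_nbhd (k *\<^sub>R v) \<delta> \<subseteq> segment_nbhd v \<delta>"
proof
  fix y assume "y \<in> segment_nbhd (k *\<^sub>R v) \<delta>"
  then obtain s where "s \<in> {0..1}" "norm (y - (s * k) *\<^sub>R v) \<le> \<delta>"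
    by (auto simp: segment_nbhd_def)
  moreover from this(1) have "s * k \<in> {0..1}"
    using assms by (simp add: mult_le_one)
  ultimately show "y \<in> segment_nbhd v \<delta>"
    unfolding segment_nbhd_def by blast
qed

definition nonresonant :: "'a::real_inner set \<Rightarrow> 'a \<Rightarrow> real \<Rightarrow> real \<Rightarrow> bool" where
  "nonresonant L v R m \<longleftrightarrow> (\<forall>q\<in>relative_dual L. q \<noteq> 0 \<longrightarrow> norm q \<le> R \<longrightarrow> m \<le> \<bar>q \<bullet> v\<bar>)"

lemma nonresonant_scaleR:
  assumes "nonresonant L v R m" "k > 0"
  shows "nonresonant L (k *\<^sub>R v) R (k * m)"
  using assms by (simp add: nonresonant_def abs_mult)

definition segment_stretch :: "real \<Rightarrow> 'a::real_inner \<Rightarrow> 'a \<Rightarrow> 'a" where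
  "segment_stretch \<delta> v y = \<delta> *\<^sub>R y + ((y \<bullet> sgn v) / 2) *\<^sub>R v"

lemma linear_segment_stretch: "linear (segment_stretch \<delta> v)"
  unfolding segment_stretch_def
  by (rule linearI) (auto simp: algebra_simps inner_add_left add_divide_distrib)

lemma segment_stretch_self_adjoint: "segment_stretch \<delta> v x \<bullet> y = x \<bullet> segment_stretch \<delta> v y"
  by (simp add: segment_stretch_def sgn_div_norm inner_add_left inner_add_right inner_commute)

lemma inner_sgn_self: "v \<bullet> sgn v = norm v" for v :: "'a::real_inner"
  by (cases "v = 0") (simp_all add: sgn_div_norm power2_norm_eq_inner[symmetric] power2_eq_square)

lemma abs_inner_sgn_le: "\<bar>y \<bullet> sgn v\<bar> \<le> norm y" for v :: "'a::real_inner"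
  using Cauchy_Schwarz_ineq2[of y "sgn v"] by (simp add: norm_sgn split: if_splits)

lemma norm_segment_stretch_ge:
  assumes "0 \<le> \<delta>"
  shows "\<delta> * norm y \<le> norm (segment_stretch \<delta> v y)"
proof (cases "y = 0")
  case False
  have "(y \<bullet> sgn v) * (y \<bullet> v) = (y \<bullet> v)\<^sup>2 / norm v"
    by (simp add: sgn_div_norm power2_eq_square divide_inverse)
  then have "0 \<le> (y \<bullet> sgn v) * (y \<bullet> v)"
    by simp
  then have "norm y * (\<delta> * norm y) \<le> y \<bullet> segment_stretch \<delta> v y"
    by (simp add: segment_stretch_def inner_add_right power2_norm_eq_inner[symmetric]
        power2_eq_square)
  also have "\<dots> \<le> norm y * norm (segment_stretch \<delta> v y)"
    by (rule norm_cauchy_schwarz)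
  finally show ?thesis
    using False by simp
qed simp

lemma norm_segment_stretch_ge_inner:
  assumes "0 \<le> \<delta>"
  shows "\<bar>y \<bullet> v\<bar> / 2 \<le> norm (segment_stretch \<delta> v y)"
proof -
  have "y \<bullet> v = norm v * (y \<bullet> sgn v)"
    by (cases "v = 0") (simp_all add: sgn_div_norm)
  then have "\<bar>y \<bullet> v\<bar> / 2 = norm v / 2 * \<bar>y \<bullet> sgn v\<bar>"
    by (simp add: abs_mult)
  also have "\<dots> \<le> (\<delta> + norm v / 2) * \<bar>y \<bullet> sgn v\<bar>"
    using assms by (intro mult_right_mono) auto
  also have "\<dots> = \<bar>(\<delta> + norm v / 2) * (y \<bullet> sgn v)\<bar>"
    using assms by (simp add: abs_mult)
  also have "\<dots> = \<bar>segment_stretch \<delta> v y \<bullet> sgn v\<bar>"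
    by (simp add: segment_stretch_def inner_add_left inner_sgn_self algebra_simps)
  also have "\<dots> \<le> norm (segment_stretch \<delta> v y)"
    by (rule abs_inner_sgn_le)
  finally show ?thesis .
qed

lemma segment_stretch_cball_subset:
  assumes "0 \<le> \<delta>"
  shows "(+) (v /\<^sub>R 2) ` segment_stretch \<delta> v ` cball 0 1 \<subseteq> segment_nbhd v \<delta>"
proof -
  have "v /\<^sub>R 2 + segment_stretch \<delta> v u \<in> segment_nbhd v \<delta>" if u: "norm u \<le> 1" for u
  proof -
    define s where "s = 1/2 + (u \<bullet> sgn v) / 2"
    have "v /\<^sub>R 2 + segment_stretch \<delta> v u - s *\<^sub>R v = \<delta> *\<^sub>R u"
      by (simp add: s_def segment_stretch_def algebra_simps)
    then have "norm (v /\<^sub>R 2 + segment_stretch \<delta> v u - s *\<^sub>R v) \<le> \<delta>"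
      using u assms by (simp add: mult_left_le)
    moreover have "s \<in> {0..1}"
      using abs_inner_sgn_le[of u v] u by (simp add: s_def abs_le_iff)
    ultimately show ?thesis
      unfolding segment_nbhd_def by blast
  qed
  then show ?thesis
    by auto
qed

lemma inj_segment_stretch:
  assumes "0 < \<delta>"
  shows "inj (segment_stretch \<delta> v)"
proof (rule linear_injective_0[OF linear_segment_stretch, THEN iffD2], intro allI impI)
  fix y assume "segment_stretch \<delta> v y = 0"
  then show "y = 0"
    using norm_segment_stretch_ge[of \<delta> y v] assms by (simp add: mult_le_0_iff)
qed

lemma norm_segment_stretch_dual_ge:
  assumes \<delta>: "0 < \<delta>" and v: "nonresonant L v (c / \<delta>) (2 * c)" and q: "q \<in> relative_dual L" "q \<noteq> 0"
  shows "c \<le> norm (segment_stretch \<delta> v q)"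
proof (cases "norm q \<le> c / \<delta>")
  case True
  then have "2 * c \<le> \<bar>q \<bullet> v\<bar>"
    using v q by (simp add: nonresonant_def)
  then show ?thesis
    using norm_segment_stretch_ge_inner[of \<delta> q v] \<delta> by simp
next
  case False
  then have "c \<le> \<delta> * norm q"
    using \<delta> by (simp add: field_simps)
  then show ?thesis
    using norm_segment_stretch_ge[of \<delta> q v] \<delta> by simp
qed

lemma segment_cover_strongly_nonresonant:
  fixes L :: "'a::euclidean_space set"
  assumes L: "discrete_subgroup L" and v: "v \<in> span L" and \<delta>: "0 < \<delta>" and c: "3 ^ dim L \<le> c"
    and v_nonresonant: "nonresonant L v (c / \<delta>) (2 * c)"
  shows "translates_cover L (segment_nbhd v \<delta>)"
proof -
  let ?B = "segment_stretch \<delta> v"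
  have c0: "0 < c"
    using c zero_less_power[of "3::real" "dim L"] by linarith
  have "?B ` span L \<subseteq> span L"
    using v by (auto simp: segment_stretch_def intro!: span_add span_scale)
  then have "translates_cover L (?B ` cball 0 (3 ^ dim L / c))"
    by (rule transference_self_adjoint[OF L linear_segment_stretch inj_segment_stretch[OF \<delta>] _
          segment_stretch_self_adjoint c0 norm_segment_stretch_dual_ge[OF \<delta> v_nonresonant]])
  moreover have "?B ` cball 0 (3 ^ dim L / c) \<subseteq> ?B ` cball 0 1"
    using c c0 by (intro image_mono subset_cball) simp
  ultimately have "translates_cover L (?B ` cball 0 1)"
    by (rule translates_cover_mono)
  then have "translates_cover L ((+) (v /\<^sub>R 2) ` ?B ` cball 0 1)"
    by (rule translates_cover_translation) (rule span_scale[OF v])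
  then show ?thesis
    by (rule translates_cover_mono[OF _ segment_stretch_cball_subset[OF less_imp_le[OF \<delta>]]])
qed

lemma unit_segment_window:
  fixes h t \<eta> :: real
  assumes "1 \<le> h" "0 \<le> t" "t \<le> 1" "0 \<le> \<eta>" "\<eta> \<le> 1"
  obtains s where "0 \<le> s" "s + \<eta> / h \<le> 1" "t \<in> {s * h..s * h + \<eta>}"
  by (rule that[of "max 0 ((t - \<eta>) / h)"]) (use assms in \<open>auto simp: max_def field_simps\<close>)

context primitive_dual_vector
begin

text \<open>The lifts of \<open>q\<close> to \<open>L\<close> form a progression with step \<open>p\<close>; the one whose value at \<open>v\<close> is
  nearest to 0 has value in \<open>(-1, 1)\<close> and must therefore be long.\<close>

lemma norm_lift_dual_section_gt:
  assumes v: "nonresonant L v R 1" "0 < p \<bullet> v" "p \<bullet> v < 2"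
    and q: "q \<in> relative_dual (hyperplane_section p L)" "q \<noteq> 0"
  shows "R < norm q + (\<bar>q \<bullet> v\<bar> / (p \<bullet> v) + 1) * norm p"
proof -
  define slope where "slope = (q \<bullet> v) / (p \<bullet> v)"
  define k where "k = round (q \<bullet> b - slope)"
  define m where "m = of_int k - q \<bullet> b"
  define q' where "q' = q + m *\<^sub>R p"
  have m: "\<bar>m + slope\<bar> \<le> 1/2"
    using of_int_round_abs_le[of "q \<bullet> b - slope"] by (simp add: m_def k_def algebra_simps)
  have "q' = (q - (q \<bullet> b) *\<^sub>R p) + of_int k *\<^sub>R p"
    by (simp add: q'_def m_def algebra_simps)
  then have q': "q' \<in> relative_dual L"
    using additive_subgroup_add additive_subgroup_of_int_scaleR additive_subgroup_relative_dual
      lift_dual_section[OF q(1)] dual by metis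
  have "q \<bullet> q' = q \<bullet> q"
    by (simp add: q'_def inner_add_right inner_dual_section_eq_0[OF q(1)])
  then have "q' \<noteq> 0"
    using q(2) by auto
  have "q' \<bullet> v = (m + slope) * (p \<bullet> v)"
    using v(2) by (simp add: q'_def inner_add_left slope_def algebra_simps)
  then have "\<bar>q' \<bullet> v\<bar> \<le> 1/2 * (p \<bullet> v)"
    using m v(2) by (simp add: abs_mult mult_right_mono)
  then have "R < norm q'"
    using v(1,3) q' \<open>q' \<noteq> 0\<close> by (force simp: nonresonant_def)
  also have "\<dots> \<le> norm q + \<bar>m\<bar> * norm p"
    using norm_triangle_ineq[of q "m *\<^sub>R p"] by (simp add: q'_def)
  also have "\<dots> \<le> norm q + (\<bar>slope\<bar> + 1) * norm p"
    using m by (intro add_left_mono mult_right_mono norm_ge_zero) linarith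
  finally show ?thesis
    using v(2) by (simp add: slope_def)
qed

text \<open>While \<open>p \<bullet> (s v)\<close> increases by \<open>\<eta>\<close>, the segment stays within \<open>\<eta> / \<bar>p\<bar>\<close> of a single layer of
  \<open>L\<close>, so that covering the layer by the projection of this piece suffices.\<close>

lemma segment_cover_from_section:
  assumes v: "v \<in> span L" "1 \<le> p \<bullet> v" and \<eta>: "0 \<le> \<eta>" "\<eta> \<le> 1"
    and cover: "translates_cover (hyperplane_section p L)
      (segment_nbhd ((\<eta> / (p \<bullet> v)) *\<^sub>R hyperplane_proj p v) \<rho>)"
  shows "translates_cover L (segment_nbhd v (\<rho> + \<eta> / norm p))"
proof (rule translates_cover_if_slab[of 0])
  fix y assume y: "y \<in> span L" "0 \<le> p \<bullet> y" "p \<bullet> y < 0 + 1"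
  define h where "h = p \<bullet> v"
  have h: "1 \<le> h"
    using v(2) by (simp add: h_def)
  obtain s\<^sub>1 where s\<^sub>1: "0 \<le> s\<^sub>1" "s\<^sub>1 + \<eta> / h \<le> 1" "p \<bullet> y \<in> {s\<^sub>1 * h..s\<^sub>1 * h + \<eta>}"
    using unit_segment_window[OF h _ _ \<eta>, of "p \<bullet> y"] y(2,3) by auto
  have "y - s\<^sub>1 *\<^sub>R v \<in> span L"
    using y(1) v(1) by (simp add: span_diff span_scale)
  then obtain \<tau> l where \<tau>: "\<tau> \<in> {0..1}" and l: "l \<in> hyperplane_section p L"
    and near: "norm (hyperplane_proj p (y - s\<^sub>1 *\<^sub>R v) - l -
      \<tau> *\<^sub>R (\<eta> / h) *\<^sub>R hyperplane_proj p v) \<le> \<rho>"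
    using cover hyperplane_proj_mem_span_section
    unfolding translates_cover_def segment_nbhd_def h_def by blast
  define s where "s = s\<^sub>1 + \<tau> * (\<eta> / h)"
  have "y - s *\<^sub>R v = (y - s\<^sub>1 *\<^sub>R v) - \<tau> *\<^sub>R (\<eta> / h) *\<^sub>R v"
    by (simp add: s_def scaleR_left_distrib)
  then have "hyperplane_proj p (y - s *\<^sub>R v) =
      hyperplane_proj p (y - s\<^sub>1 *\<^sub>R v) - \<tau> *\<^sub>R (\<eta> / h) *\<^sub>R hyperplane_proj p v"
    by (simp only: linear_diff[OF linear_hyperplane_proj] linear_scale[OF linear_hyperplane_proj])
  then have proj: "norm (hyperplane_proj p (y - s *\<^sub>R v) - l) \<le> \<rho>"
    using near by (simp add: diff_diff_eq add.commute)
  have \<tau>\<eta>: "0 \<le> \<tau> * \<eta>" "\<tau> * \<eta> \<le> \<eta>"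
    using \<tau> \<eta>(1) by (auto simp: mult_left_le_one_le)
  moreover have "p \<bullet> (y - s *\<^sub>R v) = (p \<bullet> y - s\<^sub>1 * h) - \<tau> * \<eta>"
    using h by (simp add: s_def inner_diff_right h_def[symmetric] field_simps)
  ultimately have "\<bar>p \<bullet> (y - s *\<^sub>R v)\<bar> \<le> \<eta>"
    using s\<^sub>1(3) unfolding atLeastAtMost_iff by linarith
  then have "\<bar>p \<bullet> (y - s *\<^sub>R v)\<bar> / norm p \<le> \<eta> / norm p"
    by (rule divide_right_mono) simp
  then have "norm (y - s *\<^sub>R v - l) \<le> \<rho> + \<eta> / norm p"
    using norm_diff_le_hyperplane_proj[of "y - s *\<^sub>R v" l p] proj by linarith
  moreover have "0 \<le> \<tau> * (\<eta> / h)" "\<tau> * (\<eta> / h) \<le> \<eta> / h"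
    using \<tau>\<eta> h by (auto simp: divide_right_mono)
  then have "s \<in> {0..1}"
    using s\<^sub>1(1,2) by (auto simp: s_def)
  ultimately show "\<exists>l\<in>hyperplane_section p L. y - l \<in> segment_nbhd v (\<rho> + \<eta> / norm p)"
    using l by (intro bexI[of _ l]) (auto simp: segment_nbhd_def algebra_simps)
qed

lemma nonresonant_section:
  assumes v: "nonresonant L v R 1" "1 \<le> p \<bullet> v" "p \<bullet> v < 2" and \<delta>: "0 < \<delta>" and c: "0 \<le> c"
    and R: "6 * c / \<delta> + (1 + 2 * c) * norm p \<le> R" and \<eta>: "\<eta> = min 1 (\<delta> * norm p / 2)"
  shows "nonresonant (hyperplane_section p L) ((\<eta> / (p \<bullet> v)) *\<^sub>R hyperplane_proj p v)
    (c / (\<delta> / 2)) (2 * c)"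
  unfolding nonresonant_def
proof (intro ballI impI)
  fix q assume q: "q \<in> relative_dual (hyperplane_section p L)" "q \<noteq> 0" "norm q \<le> c / (\<delta> / 2)"
  define slope where "slope = \<bar>q \<bullet> v\<bar> / (p \<bullet> v)"
  have \<eta>0: "0 < \<eta>"
    using \<delta> nonzero by (simp add: \<eta>)
  have "R < norm q + (slope + 1) * norm p"
    unfolding slope_def using v q by (intro norm_lift_dual_section_gt) auto
  then have "R < norm q + norm p + slope * norm p"
    by (simp add: algebra_simps)
  moreover have "norm q \<le> 2 * (c / \<delta>)"
    using q(3) by (simp add: mult.commute)
  moreover have "6 * (c / \<delta>) + norm p + 2 * c * norm p \<le> R"
    using R by (simp add: algebra_simps)
  moreover have "2 * c * norm p / \<eta> \<le> 4 * (c / \<delta>) + 2 * c * norm p"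
    using \<delta> c nonzero by (auto simp: \<eta> min_def field_simps)
  ultimately have "2 * c * norm p / \<eta> \<le> slope * norm p"
    by linarith
  then have "2 * c \<le> \<eta> * slope"
    using \<eta>0 nonzero by (simp add: field_simps)
  also have "\<dots> = \<bar>q \<bullet> ((\<eta> / (p \<bullet> v)) *\<^sub>R hyperplane_proj p v)\<bar>"
    using \<eta>0 v(2) inner_hyperplane_proj[OF inner_dual_section_eq_0[OF q(1)]]
    by (simp add: slope_def abs_mult)
  finally show "2 * c \<le> \<bar>q \<bullet> ((\<eta> / (p \<bullet> v)) *\<^sub>R hyperplane_proj p v)\<bar>" .
qed

lemma segment_cover_primitive_resonance:
  assumes L: "discrete_subgroup L" and v: "v \<in> span L" "nonresonant L v R 1" "1 \<le> p \<bullet> v" "p \<bullet> v < 2"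
    and \<delta>: "0 < \<delta>" and c: "3 ^ dim L \<le> c" and R: "6 * c / \<delta> + (1 + 2 * c) * norm p \<le> R"
  shows "translates_cover L (segment_nbhd v \<delta>)"
proof -
  define \<eta> where "\<eta> = min 1 (\<delta> * norm p / 2)"
  have \<eta>: "0 \<le> \<eta>" "\<eta> \<le> 1" "\<eta> / norm p \<le> \<delta> / 2"
    using \<delta> nonzero by (auto simp: \<eta>_def field_simps)
  have "3 ^ dim (hyperplane_section p L) \<le> (3::real) ^ dim L"
    using dim_section_less by (intro power_increasing) auto
  then have "3 ^ dim (hyperplane_section p L) \<le> c" "0 \<le> c"
    using c zero_le_power[of "3::real" "dim L"] by linarith+
  then have "translates_cover (hyperplane_section p L)
      (segment_nbhd ((\<eta> / (p \<bullet> v)) *\<^sub>R hyperplane_proj p v) (\<delta> / 2))"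
    using v \<delta> R hyperplane_proj_mem_span_section[OF v(1)]
    by (intro segment_cover_strongly_nonresonant[where c = c]
        discrete_subgroup_hyperplane_section[OF L] nonresonant_section[OF v(2)])
      (auto simp: \<eta>_def span_scale)
  then have "translates_cover L (segment_nbhd v (\<delta> / 2 + \<eta> / norm p))"
    by (rule segment_cover_from_section[OF v(1,3) \<eta>(1,2)])
  moreover have "segment_nbhd v (\<delta> / 2 + \<eta> / norm p) \<subseteq> segment_nbhd v \<delta>"
    using \<eta>(3) by (intro segment_nbhd_mono) linarith
  ultimately show ?thesis
    by (rule translates_cover_mono)
qed

end

lemma segment_cover_resonance:
  fixes L :: "'a::euclidean_space set"
  assumes L: "discrete_subgroup L" and v: "v \<in> span L" "nonresonant L v R 1"
    and p: "p \<in> relative_dual L" "p \<noteq> 0" "\<bar>p \<bullet> v\<bar> < 2"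
    and \<delta>: "0 < \<delta>" and c: "3 ^ dim L \<le> c" and R: "6 * c / \<delta> + (1 + 2 * c) * norm p \<le> R"
  shows "translates_cover L (segment_nbhd v \<delta>)"
proof -
  have subgroup: "additive_subgroup L"
    using L by (simp add: discrete_subgroup_def)
  have c0: "0 < c"
    using c zero_less_power[of "3::real" "dim L"] by linarith
  define p' where "p' = (if 0 \<le> p \<bullet> v then p else - p)"
  have p': "p' \<in> relative_dual L" "p' \<noteq> 0" "0 \<le> p' \<bullet> v" "p' \<bullet> v < 2" "norm p' = norm p"
    using p additive_subgroup_minus[OF additive_subgroup_relative_dual] by (auto simp: p'_def)
  obtain k b where k: "0 < k" "k \<le> 1" and prim: "primitive_dual_vector L (k *\<^sub>R p') b"
    using primitive_dual_vector_on_line[OF subgroup p'(1,2)] .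
  define u where "u = k *\<^sub>R p'"
  interpret primitive_dual_vector L u b
    unfolding u_def by (rule prim)
  have norm_u: "norm u \<le> norm p"
    using k p'(5) by (simp add: u_def mult_left_le_one_le)
  have "6 * c / \<delta> + (1 + 2 * c) * norm u \<le> 6 * c / \<delta> + (1 + 2 * c) * norm p"
    using norm_u c0 by (intro add_left_mono mult_left_mono) auto
  then have R_u: "6 * c / \<delta> + (1 + 2 * c) * norm u \<le> R"
    using R by linarith
  have "norm u \<le> 6 * c / \<delta> + (1 + 2 * c) * norm u"
    using c0 \<delta> by (simp add: algebra_simps)
  then have "1 \<le> \<bar>u \<bullet> v\<bar>"
    using v(2) dual nonzero R_u by (simp add: nonresonant_def)
  moreover have "0 \<le> u \<bullet> v" "u \<bullet> v \<le> p' \<bullet> v"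
    using k p'(3) by (auto simp: u_def mult_left_le_one_le)
  ultimately show ?thesis
    using L v \<delta> c R_u p'(4) by (intro segment_cover_primitive_resonance[where R = R]) auto
qed

lemma resonance_radius_step:
  fixes c \<delta> n :: real
  assumes c: "1 \<le> c" and \<delta>: "0 < \<delta>" and n: "n \<le> c * (9 * c) ^ N / \<delta>"
  shows "6 * c / \<delta> + (1 + 2 * c) * n \<le> c * (9 * c) ^ Suc N / \<delta>"
proof -
  define R where "R = c * (9 * c) ^ N / \<delta>"
  have "1 * c \<le> (9 * c) ^ N * c"
    using c by (intro mult_right_mono one_le_power) auto
  then have "c / \<delta> \<le> R"
    using \<delta> by (simp add: R_def divide_right_mono mult.commute)
  moreover have "R \<le> c * R"
    using mult_right_mono[OF c, of R] \<delta> c by (simp add: R_def)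
  moreover have "c * n \<le> c * R"
    using n c by (intro mult_left_mono) (auto simp: R_def)
  ultimately have "6 * (c / \<delta>) + n + 2 * (c * n) \<le> 9 * (c * R)"
    using n unfolding R_def[symmetric] by linarith
  then have "6 * c / \<delta> + (1 + 2 * c) * n \<le> 9 * (c * R)"
    by (simp add: algebra_simps)
  also have "\<dots> = c * (9 * c) ^ Suc N / \<delta>"
    by (simp add: R_def)
  finally show ?thesis .
qed

text \<open>Lower the radius one step at a time: either the nonresonance bound doubles, or a vector where
  it fails to do so is a resonance of \<open>v / m\<close>.\<close>

lemma segment_cover_nonresonant:
  fixes L :: "'a::euclidean_space set"
  assumes L: "discrete_subgroup L" and v: "v \<in> span L" and \<delta>: "0 < \<delta>" and c: "3 ^ dim L \<le> c"
    and "1 \<le> m" "2 * c \<le> 2 ^ N * m" "nonresonant L v (c * (9 * c) ^ N / \<delta>) m"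
  shows "translates_cover L (segment_nbhd v \<delta>)"
  using assms(5-)
proof (induction N arbitrary: m)
  case 0
  then have "nonresonant L v (c / \<delta>) (2 * c)"
    by (force simp: nonresonant_def)
  then show ?case
    by (rule segment_cover_strongly_nonresonant[OF L v \<delta> c])
next
  case (Suc N)
  show ?case
  proof (cases "nonresonant L v (c * (9 * c) ^ N / \<delta>) (2 * m)")
    case True
    then show ?thesis
      using Suc.IH[of "2 * m"] Suc.prems(1,2) by simp
  next
    case False
    then obtain p where p: "p \<in> relative_dual L" "p \<noteq> 0" "norm p \<le> c * (9 * c) ^ N / \<delta>"
      "\<bar>p \<bullet> v\<bar> < 2 * m"
      by (auto simp: nonresonant_def not_le)
    have c1: "1 \<le> c"
      using c one_le_power[of "3::real" "dim L"] by linarith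
    have "6 * c / \<delta> + (1 + 2 * c) * norm p \<le> c * (9 * c) ^ Suc N / \<delta>"
      using resonance_radius_step[OF c1 \<delta>] p(3) .
    moreover have "nonresonant L ((1 / m) *\<^sub>R v) (c * (9 * c) ^ Suc N / \<delta>) 1"
      using nonresonant_scaleR[OF Suc.prems(3), of "1 / m"] Suc.prems(1) by simp
    moreover have "\<bar>p \<bullet> ((1 / m) *\<^sub>R v)\<bar> < 2"
      using p(4) Suc.prems(1) by (simp add: field_simps)
    ultimately have "translates_cover L (segment_nbhd ((1 / m) *\<^sub>R v) \<delta>)"
      using v p(1,2) by (intro segment_cover_resonance[OF L _ _ _ _ _ \<delta> c]) (auto intro: span_scale)
    then show ?thesis
      using segment_nbhd_scaleR_subset[of "1 / m" v \<delta>] Suc.prems(1)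
      by (auto intro: translates_cover_mono)
  qed
qed

section \<open>Discrete subgroups of finite covolume\<close>

lemma countable_uniform_discrete:
  fixes S :: "'a::euclidean_space set"
  assumes "uniform_discrete S"
  shows "countable S"
  using sparse_imp_countable[OF open_UNIV uniform_discrete_imp_sparse[OF assms]] by simp

lemma emeasure_lebesgue_translation:
  fixes S :: "'a::euclidean_space set"
  shows "emeasure lebesgue ((+) a ` S) = emeasure lebesgue S"
  using emeasure_lebesgue_affine[of 1 a S] by (simp add: ac_simps cong: image_cong_simp)

lemma disjoint_family_translates:
  fixes D :: "'a::group_add set" and X :: "'i \<Rightarrow> 'a set"
  assumes X: "disjoint_family X" "\<And>n. X n \<subseteq> D"
    and packing: "disjoint_family_on (\<lambda>l. (+) (- l) ` D) L" and g: "range g \<subseteq> L"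
  shows "disjoint_family (\<lambda>n. (+) (- g n) ` X n)"
  unfolding disjoint_family_on_def
proof (intro ballI impI)
  fix m n :: 'i assume "m \<noteq> n"
  show "(+) (- g m) ` X m \<inter> (+) (- g n) ` X n = {}"
  proof (cases "g m = g n")
    case True
    have "X m \<inter> X n = {}"
      using X(1) \<open>m \<noteq> n\<close> by (auto simp: disjoint_family_on_def)
    then show ?thesis
      using True by auto
  next
    case False
    then have "(+) (- g m) ` D \<inter> (+) (- g n) ` D = {}"
      using packing g by (simp add: disjoint_family_on_def image_subset_iff)
    then show ?thesis
      using X(2) by blast
  qed
qed

text \<open>Cut the packed set along the covering translates and move the pieces back into \<open>F\<close>.\<close>

lemma emeasure_packing_le_covering:
  fixes L D F :: "'a::euclidean_space set"
  assumes L: "countable L" and D: "D \<in> sets lebesgue" and F: "F \<in> sets lebesgue"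
    and packing: "disjoint_family_on (\<lambda>l. (+) (- l) ` D) L"
    and covering: "D \<subseteq> (\<Union>l\<in>L. (+) l ` F)"
  shows "emeasure lebesgue D \<le> emeasure lebesgue F"
proof (cases "L = {}")
  case True
  then show ?thesis
    using covering by simp
next
  case False
  define g where "g = from_nat_into L"
  have g: "range g = L"
    using L False by (simp add: g_def range_from_nat_into)
  define X where "X = disjointed (\<lambda>n. D \<inter> (+) (g n) ` F)"
  define Y where "Y = (\<lambda>n. (+) (- g n) ` X n)"
  have X: "range X \<subseteq> sets lebesgue"
    unfolding X_def using D F
    by (intro sets.range_disjointed_sets image_subsetI sets.Int lebesgue_sets_translation)
  have Y: "range Y \<subseteq> sets lebesgue"
    unfolding Y_def using X by (intro image_subsetI lebesgue_sets_translation) blast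
  have X_subset: "X n \<subseteq> D \<inter> (+) (g n) ` F" for n
    unfolding X_def by (rule disjointed_subset)
  have disjoint_X: "disjoint_family X"
    unfolding X_def by (rule disjoint_family_disjointed)
  have disjoint_Y: "disjoint_family Y"
    unfolding Y_def using disjoint_X X_subset packing g
    by (intro disjoint_family_translates[where D = D and L = L]) auto
  have "D = (\<Union>n. X n)"
    using covering unfolding X_def UN_disjointed_eq g[symmetric] by blast
  then have "emeasure lebesgue D = (\<Sum>n. emeasure lebesgue (X n))"
    using suminf_emeasure[OF X disjoint_X] by simp
  also have "\<dots> = (\<Sum>n. emeasure lebesgue (Y n))"
    unfolding Y_def emeasure_lebesgue_translation ..
  also have "\<dots> = emeasure lebesgue (\<Union>n. Y n)"
    by (rule suminf_emeasure[OF Y disjoint_Y])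
  also have "\<dots> \<le> emeasure lebesgue F"
    using X_subset F by (intro emeasure_mono) (fastforce simp: Y_def)+
  finally show ?thesis .
qed

lemma emeasure_disjoint_balls:
  fixes a :: "nat \<Rightarrow> 'a::euclidean_space"
  assumes "0 < r" "disjoint_family (\<lambda>n. ball (a n) r)"
  shows "emeasure lebesgue (\<Union>n. ball (a n) r) = \<infinity>"
proof -
  define C where "C = ennreal (unit_ball_vol (real DIM('a)) * r ^ DIM('a))"
  have "C \<noteq> 0"
    using assms(1) unit_ball_vol_pos[of "real DIM('a)"] unfolding C_def
    by (simp add: ennreal_eq_0_iff not_le)
  have "emeasure lebesgue (\<Union>n. ball (a n) r) = (\<Sum>n. emeasure lebesgue (ball (a n) r))"
    by (rule suminf_emeasure[OF _ assms(2), symmetric]) auto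
  also have "\<dots> = (\<Sum>n::nat. C)"
    using assms(1) by (simp add: C_def emeasure_ball)
  also have "\<dots> = \<infinity>"
    using \<open>C \<noteq> 0\<close> by (simp add: nn_integral_count_space_nat[symmetric] ennreal_mult_top)
  finally show ?thesis .
qed

lemma disjoint_family_balls_multiples:
  fixes w :: "'a::real_normed_vector"
  shows "disjoint_family (\<lambda>n. ball (real n *\<^sub>R w) (norm w / 2))"
  unfolding disjoint_family_on_def
proof (intro ballI impI disjoint_ballI)
  fix m n :: nat assume "m \<noteq> n"
  then have "1 * norm w \<le> \<bar>real m - real n\<bar> * norm w"
    by (intro mult_right_mono) auto
  then show "norm w / 2 + norm w / 2 \<le> dist (real m *\<^sub>R w) (real n *\<^sub>R w)"
    by (simp add: dist_norm flip: scaleR_left_diff_distrib)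
qed

lemma packing_balls_along_normal:
  fixes L :: "'a::real_inner set"
  assumes L: "additive_subgroup L" "\<And>x. x \<in> L \<Longrightarrow> x \<noteq> 0 \<Longrightarrow> r \<le> norm x"
    and w: "\<And>x. x \<in> L \<Longrightarrow> x \<bullet> w = 0"
  shows "disjoint_family_on (\<lambda>l. (+) (- l) ` (\<Union>n. ball (real n *\<^sub>R w) (r / 2))) L"
  unfolding disjoint_family_on_def
proof (intro ballI impI, rule ccontr)
  let ?D = "\<Union>n. ball (real n *\<^sub>R w) (r / 2)"
  fix k l assume kl: "k \<in> L" "l \<in> L" "k \<noteq> l" and "(+) (- k) ` ?D \<inter> (+) (- l) ` ?D \<noteq> {}"
  then obtain x y m n where x: "norm (x - real m *\<^sub>R w) < r / 2"
    and y: "norm (y - real n *\<^sub>R w) < r / 2" and "- k + x = - l + y"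
    by (auto simp: dist_norm norm_minus_commute)
  define d where "d = k - l"
  have d: "d \<in> L" "d \<noteq> 0"
    using kl L(1) by (auto simp: d_def additive_subgroup_diff)
  define e where "e = (x - real m *\<^sub>R w) - (y - real n *\<^sub>R w)"
  have "d = e + (real m - real n) *\<^sub>R w"
    using \<open>- k + x = - l + y\<close> by (simp add: d_def e_def algebra_simps)
  then have "d \<bullet> d = d \<bullet> e + (real m - real n) * (d \<bullet> w)"
    by (metis inner_add_right inner_scaleR_right)
  then have "norm d * norm d = d \<bullet> e"
    using w[OF d(1)] by (simp add: power2_norm_eq_inner[symmetric] power2_eq_square)
  also have "\<dots> \<le> norm d * norm e"
    by (rule norm_cauchy_schwarz)
  finally have "norm d \<le> norm e"
    using d(2) by simp
  also have "\<dots> < r / 2 + r / 2"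
    unfolding e_def using norm_triangle_ineq4 add_strict_mono[OF x y] by (rule le_less_trans)
  finally show False
    using L(2)[OF d] by simp
qed

text \<open>If \<open>L\<close> does not span, equidistant balls along a normal to \<open>L\<close> have infinite total volume and
  disjoint \<open>L\<close>-translates.\<close>

lemma span_eq_UNIV_if_finite_covolume:
  fixes L F :: "'a::euclidean_space set"
  assumes L: "discrete_subgroup L"
    and F: "F \<in> sets lebesgue" "emeasure lebesgue F < \<infinity>" "(\<Union>l\<in>L. (+) l ` F) = UNIV"
  shows "span L = UNIV"
proof (rule ccontr)
  assume "span L \<noteq> UNIV"
  then obtain p where p: "p \<noteq> 0" "\<And>x. x \<in> L \<Longrightarrow> p \<bullet> x = 0"
    using span_not_UNIV_orthogonal by (metis span_base)
  obtain r where r: "0 < r" "\<And>x. x \<in> L \<Longrightarrow> x \<noteq> 0 \<Longrightarrow> r \<le> norm x"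
    using discrete_subgroup_norm_ge[OF L] by blast
  define w where "w = r *\<^sub>R sgn p"
  have w: "norm w = r"
    using p(1) r(1) by (simp add: w_def norm_sgn)
  have normal: "x \<bullet> w = 0" if "x \<in> L" for x
    using p(2)[OF that] by (simp add: w_def sgn_div_norm inner_commute)
  define D where "D = (\<Union>n. ball (real n *\<^sub>R w) (r / 2))"
  have "disjoint_family_on (\<lambda>l. (+) (- l) ` D) L"
    unfolding D_def using L r(2) normal
    by (intro packing_balls_along_normal) (auto simp: discrete_subgroup_def)
  moreover have "countable L"
    using L by (simp add: discrete_subgroup_def countable_uniform_discrete)
  moreover have "D \<in> sets lebesgue"
    by (auto simp: D_def intro!: sets.countable_UN')
  ultimately have "emeasure lebesgue D \<le> emeasure lebesgue F"
    using F by (intro emeasure_packing_le_covering[of L]) auto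
  moreover have "emeasure lebesgue D = \<infinity>"
    unfolding D_def using r(1) disjoint_family_balls_multiples[of w]
    by (intro emeasure_disjoint_balls) (auto simp: w)
  ultimately show False
    using F(2) by (simp add: top.extremum_unique)
qed

lemma is_lattice_imp_discrete_subgroup:
  assumes "is_lattice L"
  shows "discrete_subgroup L"
  using assms discrete_subgroupI[of L] by (auto simp: is_lattice_def additive_subgroup_def)

lemma is_lattice_imp_span_eq_UNIV:
  assumes "is_lattice L"
  shows "span L = UNIV"
proof -
  obtain F where F: "F \<in> sets lebesgue" "emeasure lebesgue F < \<infinity>" "\<And>x. \<exists>f\<in>F. \<exists>l\<in>L. x = f + l"
    using assms unfolding is_lattice_def by blast
  have "(\<Union>l\<in>L. (+) l ` F) = UNIV"
    using F(3) by (force simp: add.commute)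
  then show ?thesis
    using span_eq_UNIV_if_finite_covolume[OF is_lattice_imp_discrete_subgroup[OF assms]] F by blast
qed

section \<open>The covering time\<close>

lemma Tcov_le:
  assumes "span L = UNIV" "0 \<le> t" "translates_cover L (segment_nbhd (t *\<^sub>R \<Omega>) \<delta>)"
  shows "Tcov L \<Omega> \<delta> \<le> ereal t"
proof -
  have "infdist x (orbit_set L \<Omega> t) \<le> \<delta>" for x
  proof -
    obtain l s where l: "l \<in> L" and s: "s \<in> {0..1}" and "norm (x - l - s *\<^sub>R t *\<^sub>R \<Omega>) \<le> \<delta>"
      using assms(1,3) unfolding translates_cover_def segment_nbhd_def by blast
    then have "dist x ((s * t) *\<^sub>R \<Omega> + l) \<le> \<delta>"
      by (simp add: dist_norm algebra_simps)
    moreover have "s * t \<in> {0..t}"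
      using s assms(2) by (simp add: mult_left_le_one_le)
    then have "(s * t) *\<^sub>R \<Omega> + l \<in> orbit_set L \<Omega> t"
      using l unfolding orbit_set_def by blast
    ultimately show ?thesis
      using infdist_le order_trans by blast
  qed
  then show ?thesis
    unfolding Tcov_def using assms(2) by (intro Inf_lower) auto
qed

lemma alpha_le:
  assumes "span L = UNIV" "q \<in> relative_dual L" "q \<noteq> 0" "norm q \<le> R"
  shows "alpha L \<Omega> R \<le> ereal \<bar>q \<bullet> \<Omega>\<bar>"
  unfolding alpha_def using assms
  by (intro Inf_lower) (auto simp: dual_ball_def dual_lattice_def relative_dual_def)

lemma inv_conv_alpha_cases:
  assumes "span L = UNIV"
  obtains "inv_conv (alpha L \<Omega> R) = \<infinity>"
  | t where "0 \<le> t" "inv_conv (alpha L \<Omega> R) = ereal t" "nonresonant L (t *\<^sub>R \<Omega>) R 1"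
proof -
  have "0 \<le> alpha L \<Omega> R"
    unfolding alpha_def by (intro Inf_greatest) auto
  then consider "alpha L \<Omega> R = 0" | "alpha L \<Omega> R = \<infinity>" | m where "alpha L \<Omega> R = ereal m" "0 < m"
    by (cases "alpha L \<Omega> R") (auto simp: order_le_less)
  then show thesis
  proof cases
    case 1
    then show thesis
      using that(1) by (simp add: inv_conv_def)
  next
    case 2
    then have "nonresonant L (0 *\<^sub>R \<Omega>) R 1"
      using alpha_le[OF assms, of _ R \<Omega>] by (force simp: nonresonant_def)
    then show thesis
      using that(2)[of 0] 2 by (simp add: inv_conv_def zero_ereal_def)
  next
    case (3 m)
    then have "nonresonant L \<Omega> R m"
      using alpha_le[OF assms, of _ R \<Omega>] by (auto simp: nonresonant_def)
    then have "nonresonant L ((1 / m) *\<^sub>R \<Omega>) R 1"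
      using nonresonant_scaleR[of L \<Omega> R m "1 / m"] 3(2) by simp
    then show thesis
      using that(2)[of "1 / m"] 3 by (simp add: inv_conv_def)
  qed
qed

lemma Tcov_le_inv_conv_alpha:
  assumes L: "discrete_subgroup L" "span L = UNIV" and \<delta>: "0 < \<delta>"
    and c: "3 ^ dim L \<le> c" and N: "2 * c \<le> 2 ^ N"
  shows "Tcov L \<Omega> \<delta> \<le> inv_conv (alpha L \<Omega> (c * (9 * c) ^ N / \<delta>))"
proof (cases rule: inv_conv_alpha_cases[OF L(2), of \<Omega> "c * (9 * c) ^ N / \<delta>"])
  case (2 t)
  have "translates_cover L (segment_nbhd (t *\<^sub>R \<Omega>) \<delta>)"
    using 2(3) N L(2) by (intro segment_cover_nonresonant[OF L(1) _ \<delta> c, of _ 1 N]) auto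
  then show ?thesis
    using Tcov_le[OF L(2) 2(1)] 2(2) by metis
qed simp

theorem theorem4p2:
  "\<exists>a::real. a > 0 \<and>
     (\<forall>(L::(real ^ 'n) set) (\<Omega>::real ^ 'n) (\<delta>::real).
        is_lattice L \<longrightarrow> \<delta> > 0 \<longrightarrow> Tcov L \<Omega> \<delta> \<le> inv_conv (alpha L \<Omega> (a / \<delta>)))"
proof -
  define c :: real where "c = 3 ^ DIM(real ^ 'n)"
  obtain N where N: "2 * c < 2 ^ N"
    using real_arch_pow[of 2 "2 * c"] by auto
  have "Tcov L \<Omega> \<delta> \<le> inv_conv (alpha L \<Omega> (c * (9 * c) ^ N / \<delta>))"
    if L: "is_lattice L" and \<delta>: "\<delta> > 0" for L :: "(real ^ 'n) set" and \<Omega> \<delta>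
  proof (rule Tcov_le_inv_conv_alpha[OF is_lattice_imp_discrete_subgroup[OF L]
        is_lattice_imp_span_eq_UNIV[OF L] \<delta>])
    show "3 ^ dim L \<le> c"
      unfolding c_def by (intro power_increasing dim_subset_UNIV) simp
  qed (use N in simp)
  moreover have "c * (9 * c) ^ N > 0"
    by (simp add: c_def)
  ultimately show ?thesis
    by blast
qed

end
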